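(* Let $n_1,n_2\ge 1$ be integers, $n:=n_1n_2$, and let $R=\{r_{i,j}\}_{i,j=0,\dots,n-1}$ be a complex Hermitian positive definite Toeplitz-block-Toeplitz matrix with $n_2\times n_2$ blocks, each of size $n_1\times n_1$. Let $p_{k,l},q_{k,l},a_{k,l},a'_{k,l},v_{k,l},v'_{k,l}$ be the vectors, generalized reflection coefficients and scalars associated with $R$ by the recurrences given in the context. For $0\le k<l\le n-1$ put $$(k',l'):=\big(k \operatorname{sec} n_1+n_1-1-(l \bmod n_1),\ \ l \operatorname{sec} n_1+n_1-1-(k \bmod n_1)\big).$$ Then for all $0\le k<l\le n-1$: $$a_{k,l}=(a'_{k',l'})^*,\qquad a'_{k,l}=(a_{k',l'})^*,$$ $$p_{k,l}=U^{k-k'}(\tilde q_{k',l'})^*,\qquad q_{k,l}=U^{k-k'}(\tilde p_{k',l'})^*,$$ $$v_{k,l}=(v'_{k',l'})^*,\qquad v'_{k,l}=(v_{k',l'})^*.$$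
   Context: All matrices and vectors are indexed from $0$. For integers $a\ge 0$, $b\ge1$: $a \operatorname{sec} b:=b\lfloor a/b\rfloor$ and $a\bmod b:=a-(a\operatorname{sec} b)$. The superscript $*$ denotes (entrywise) complex conjugation, and $T$ denotes transpose without conjugation. Toeplitz-block-Toeplitz: $R$ is an $n_2\times n_2$ block matrix with $n_1\times n_1$ blocks, is block Toeplitz, and each block is itself a Toeplitz matrix; i.e. $r_{i,j}$ depends only on the pair $(\lfloor j/n_1\rfloor-\lfloor i/n_1\rfloor,\ (j\bmod n_1)-(i\bmod n_1))$. Recurrences: let $e_0,\dots,e_{n-1}$ be the canonical basis of $\mathbb C^n$. Start with $p_{k,k}:=q_{k,k}:=e_k$ for $k=0,\dots,n-1$. For $0\le k<l\le n-1$, by increasing $l-k$, define $$a_{k,l}=\frac{p_{k,l-1}^T R\,e_l}{q_{k+1,l}^T R\,e_l},\qquad a'_{k,l}=\frac{q_{k+1,l}^T R\,e_k}{p_{k,l-1}^T R\,e_k},$$ $$p_{k,l}=p_{k,l-1}-a_{k,l}\,q_{k+1,l},\qquad q_{k,l}=q_{k+1,l}-a'_{k,l}\,p_{k,l-1},$$ and $v_{k,l}:=q_{k,l}^T R\,e_l$, $v'_{k,l}:=p_{k,l}^T R\,e_k$ (for $k\le l$). Positive definiteness of $R$ ensures that the denominators are nonzero (indeed positive). Tilde operation: for a vector $w_{k,l}=[x_i]_{i=0,\dots,n-1}$ carrying indices $k\le l$, $\tilde w_{k,l}=[\tilde x_i]$ with $\tilde x_i=x_{l-i+k}$ if $k\le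 i\le l$, and $\tilde x_i=x_i$ otherwise. Shift: $U$ is the $n\times n$ matrix with ones on the first subdiagonal and zeros elsewhere (so $Ue_i=e_{i+1}$ for $i<n-1$, $Ue_{n-1}=0$). By convention $U^0$ is the identity, $U^{-1}$ denotes the matrix with ones on the first superdiagonal and zeros elsewhere (i.e. $U^T$, not a true inverse), and $U^{-m}:=(U^{-1})^m$ for $m\ge 1$. *)

theory Defs
  imports "Jordan_Normal_Form.Schur_Decomposition"
begin

definition sec :: "nat \<Rightarrow> nat \<Rightarrow> nat" (infixl \<open>sec\<close> 70) where
  "a sec b = b * (a div b)"

definition hermitian_positive_definite :: "complex mat \<Rightarrow> bool" where
  "hermitian_positive_definite R \<longleftrightarrow>
     square_mat R \<and> mat_adjoint R = R \<and>
     (\<forall>x \<in> carrier_vec (dim_row R). x \<noteq> 0\<^sub>v (dim_row R) \<longrightarrow> 0 < (R *\<^sub>v x) \<bullet>c x)"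

text \<open>
  An \<open>n2 \<times> n2\<close> block matrix with \<open>n1 \<times> n1\<close> blocks: the entry at \<open>(i, j)\<close> depends only on the
  difference of the block indices and the difference of the positions inside the blocks.
\<close>

definition toeplitz_block_toeplitz :: "nat \<Rightarrow> nat \<Rightarrow> 'a mat \<Rightarrow> bool" where
  "toeplitz_block_toeplitz n1 n2 R \<longleftrightarrow>
     R \<in> carrier_mat (n1 * n2) (n1 * n2) \<and>
     (\<forall>i < n1 * n2. \<forall>j < n1 * n2. \<forall>i' < n1 * n2. \<forall>j' < n1 * n2.
        int (j div n1) - int (i div n1) = int (j' div n1) - int (i' div n1) \<longrightarrow>
        int (j mod n1) - int (i mod n1) = int (j' mod n1) - int (i' mod n1) \<longrightarrow>
        R $$ (i, j) = R $$ (i', j'))"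

text \<open>
  The vectors and coefficients are only meaningful for \<open>k \<le> l\<close> (respectively \<open>k < l\<close>); outside
  this range the values are arbitrary. The product \<open>\<bullet>\<close> is bilinear, without conjugation.
\<close>

function p_vec :: "complex mat \<Rightarrow> nat \<Rightarrow> nat \<Rightarrow> complex vec"
  and q_vec :: "complex mat \<Rightarrow> nat \<Rightarrow> nat \<Rightarrow> complex vec"
  and a_coef :: "complex mat \<Rightarrow> nat \<Rightarrow> nat \<Rightarrow> complex"
  and a'_coef :: "complex mat \<Rightarrow> nat \<Rightarrow> nat \<Rightarrow> complex"
where
  "p_vec R k l =
     (if k < l then p_vec R k (l - 1) - a_coef R k l \<cdot>\<^sub>v q_vec R (k + 1) l
      else unit_vec (dim_row R) k)"
| "q_vec R k l =
     (if k < l then q_vec R (k + 1) l - a'_coef R k l \<cdot>\<^sub>v p_vec R k (l - 1)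
      else unit_vec (dim_row R) k)"
| "a_coef R k l =
     (if k < l then
        (p_vec R k (l - 1) \<bullet> (R *\<^sub>v unit_vec (dim_row R) l)) /
        (q_vec R (k + 1) l \<bullet> (R *\<^sub>v unit_vec (dim_row R) l))
      else 0)"
| "a'_coef R k l =
     (if k < l then
        (q_vec R (k + 1) l \<bullet> (R *\<^sub>v unit_vec (dim_row R) k)) /
        (p_vec R k (l - 1) \<bullet> (R *\<^sub>v unit_vec (dim_row R) k))
      else 0)"
  by pat_completeness auto
termination
  by (relation "measure (case_sum
        (case_sum (\<lambda>(R, k, l). 2 * (l - k) + 1) (\<lambda>(R, k, l). 2 * (l - k) + 1))
        (case_sum (\<lambda>(R, k, l). 2 * (l - k)) (\<lambda>(R, k, l). 2 * (l - k))))") auto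

declare p_vec.simps [simp del] q_vec.simps [simp del]
  a_coef.simps [simp del] a'_coef.simps [simp del]

definition v_coef :: "complex mat \<Rightarrow> nat \<Rightarrow> nat \<Rightarrow> complex" where
  "v_coef R k l = q_vec R k l \<bullet> (R *\<^sub>v unit_vec (dim_row R) l)"

definition v'_coef :: "complex mat \<Rightarrow> nat \<Rightarrow> nat \<Rightarrow> complex" where
  "v'_coef R k l = p_vec R k l \<bullet> (R *\<^sub>v unit_vec (dim_row R) k)"

definition tilde :: "nat \<Rightarrow> nat \<Rightarrow> 'a vec \<Rightarrow> 'a vec" where
  "tilde k l x = vec (dim_vec x) (\<lambda>i. if k \<le> i \<and> i \<le> l then x $ (l - i + k) else x $ i)"

definition shift_mat :: "nat \<Rightarrow> complex mat" where
  "shift_mat n = mat n n (\<lambda>(i, j). if i = j + 1 then 1 else 0)"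

text \<open>
  \<open>shift_mat n\<close> is nilpotent; its negative powers are, by convention, the powers of its transpose.
\<close>

definition shift_power :: "nat \<Rightarrow> int \<Rightarrow> complex mat" where
  "shift_power n m =
     (if 0 \<le> m then shift_mat n ^\<^sub>m nat m else (shift_mat n)\<^sup>T ^\<^sub>m nat (- m))"

end

theory Submission
  imports Defs
begin

text \<open>
  Reversing the index interval \<open>[k, l]\<close> about \<open>s\<close>, that is \<open>i \<mapsto> s - i\<close>, exchanges the two families of
  recurrences whenever \<open>R $$ (s - i, s - j)\<close> is the conjugate of \<open>R $$ (i, j)\<close> on \<open>[k, l]\<close>. Since this
  hypothesis passes to subintervals with the same \<open>s\<close>, the symmetry follows by induction on \<open>l - k\<close>.
  For a Hermitian Toeplitz-block-Toeplitz matrix it holds with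
  \<open>s = k sec n1 + l sec n1 + n1 - 1\<close>, because this reflection reverses both the order of the blocks
  and the order inside each block; the image of \<open>[k, l]\<close> is then \<open>[k', l']\<close>.
\<close>

section \<open>Dimensions and supports of the recurrence vectors\<close>

lemma p_q_vec_carrier:
  "p_vec R k l \<in> carrier_vec (dim_row R) \<and> q_vec R k l \<in> carrier_vec (dim_row R)"
proof (induction "l - k" arbitrary: k l rule: less_induct)
  case less
  show ?case
  proof (cases "k < l")
    case True
    then show ?thesis
      using less[of "l - 1" k] less[of l "k + 1"] by (auto simp: p_vec.simps[of R k l] q_vec.simps[of R k l])
  next
    case False
    then show ?thesis by (simp add: p_vec.simps q_vec.simps)
  qed
qed

lemmas p_vec_carrier [simp] = p_q_vec_carrier[THEN conjunct1]
lemmas q_vec_carrier [simp] = p_q_vec_carrier[THEN conjunct2]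

lemma dim_p_vec [simp]: "dim_vec (p_vec R k l) = dim_row R"
  and dim_q_vec [simp]: "dim_vec (q_vec R k l) = dim_row R"
  by (rule carrier_vecD, simp)+

lemma index_p_vec:
  "k < l \<Longrightarrow> i < dim_row R \<Longrightarrow>
    p_vec R k l $ i = p_vec R k (l - 1) $ i - a_coef R k l * q_vec R (k + 1) l $ i"
  by (simp add: p_vec.simps[of R k l])

lemma index_q_vec:
  "k < l \<Longrightarrow> i < dim_row R \<Longrightarrow>
    q_vec R k l $ i = q_vec R (k + 1) l $ i - a'_coef R k l * p_vec R k (l - 1) $ i"
  by (simp add: q_vec.simps[of R k l])

text \<open>Each recurrence step combines vectors supported in \<open>[k, l - 1]\<close> and
  \<open>[k + 1, l]\<close>, starting from unit vectors. Hence the products with \<open>R\<close>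
  only see entries with both indices in \<open>[k, l]\<close>, where the reflection hypothesis
  applies.\<close>

lemma p_q_vec_support:
  assumes "k \<le> l" "i < dim_row R" "i \<notin> {k..l}"
  shows "p_vec R k l $ i = 0 \<and> q_vec R k l $ i = 0"
  using assms
proof (induction "l - k" arbitrary: k l rule: less_induct)
  case less
  show ?case
  proof (cases "k < l")
    case True
    have "p_vec R k (l - 1) $ i = 0 \<and> q_vec R k (l - 1) $ i = 0"
      using True less.prems by (intro less.hyps) auto
    moreover have "p_vec R (k + 1) l $ i = 0 \<and> q_vec R (k + 1) l $ i = 0"
      using True less.prems by (intro less.hyps) auto
    ultimately show ?thesis
      using True less.prems by (simp add: index_p_vec index_q_vec)
  next
    case False
    then show ?thesis using less.prems by (auto simp: p_vec.simps q_vec.simps unit_vec_def)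
  qed
qed

section \<open>Reflection of products, vectors and coefficients on an index interval\<close>

lemma scalar_prod_mult_unit_vec:
  assumes "R \<in> carrier_mat n n" "x \<in> carrier_vec n" "j < n" "l < n"
    and supp: "\<And>i. i < n \<Longrightarrow> i \<notin> {k..l} \<Longrightarrow> x $ i = (0::'a::comm_ring_1)"
  shows "x \<bullet> (R *\<^sub>v unit_vec n j) = (\<Sum>i = k..l. x $ i * R $$ (i, j))"
proof -
  have "R *\<^sub>v unit_vec n j = col R j"
    using assms by (intro eq_vecI) auto
  then have "x \<bullet> (R *\<^sub>v unit_vec n j) = (\<Sum>i = 0..<n. x $ i * R $$ (i, j))"
    using assms by (auto simp: scalar_prod_def intro!: sum.cong)
  also have "\<dots> = (\<Sum>i = k..l. x $ i * R $$ (i, j))"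
    using assms by (intro sum.mono_neutral_right) auto
  finally show ?thesis .
qed

text \<open>The bound \<open>l \<le> s\<close> keeps every subtraction \<open>s - i\<close> exact on
  \<open>[k, l]\<close>, and \<open>s - k < n\<close> keeps the image \<open>[s - l, s - k]\<close>
  inside the index range.\<close>

locale reflection_symmetric =
  fixes R :: "complex mat" and n s k l :: nat
  assumes carrier: "R \<in> carrier_mat n n"
    and bounds: "k \<le> l" "l < n" "l \<le> s" "s - k < n"
    and reflect: "\<And>i j. i \<in> {k..l} \<Longrightarrow> j \<in> {k..l} \<Longrightarrow> R $$ (s - i, s - j) = cnj (R $$ (i, j))"
begin

lemma scalar_prod_reflect:
  assumes "x \<in> carrier_vec n" "y \<in> carrier_vec n" "j \<in> {k..l}"
    and "\<And>i. i < n \<Longrightarrow> i \<notin> {k..l} \<Longrightarrow> x $ i = 0"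
    and "\<And>i. i < n \<Longrightarrow> i \<notin> {s - l..s - k} \<Longrightarrow> y $ i = 0"
    and xy: "\<And>i. i \<in> {k..l} \<Longrightarrow> x $ i = cnj (y $ (s - i))"
  shows "x \<bullet> (R *\<^sub>v unit_vec n j) = cnj (y \<bullet> (R *\<^sub>v unit_vec n (s - j)))"
proof -
  have "x \<bullet> (R *\<^sub>v unit_vec n j) = (\<Sum>i = k..l. x $ i * R $$ (i, j))"
    using assms bounds by (intro scalar_prod_mult_unit_vec[OF carrier]) auto
  also have "\<dots> = (\<Sum>i = k..l. cnj (y $ (s - i) * R $$ (s - i, s - j)))"
    using xy reflect assms(3) by (intro sum.cong) auto
  \<comment> \<open>As \<open>l \<le> s\<close>, the map \<open>i \<mapsto> s - i\<close> is a
    bijection between the two intervals, with inverse given by the same formula.\<close>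
  also have "\<dots> = (\<Sum>i = s - l..s - k. cnj (y $ i * R $$ (i, s - j)))"
    by (rule sum.reindex_bij_witness[of _ "\<lambda>i. s - i" "\<lambda>i. s - i"]) (use bounds in auto)
  also have "\<dots> = cnj (y \<bullet> (R *\<^sub>v unit_vec n (s - j)))"
    using assms bounds
    by (subst scalar_prod_mult_unit_vec[OF carrier, where k = "s - l" and l = "s - k"]) auto
  finally show ?thesis .
qed

end

lemma reflection_symmetric_subinterval:
  assumes "reflection_symmetric R n s k l" "k \<le> k'" "k' \<le> l'" "l' \<le> l"
  shows "reflection_symmetric R n s k' l'"
  using assms unfolding reflection_symmetric_def by auto

context reflection_symmetric
begin

text \<open>The images of \<open>[k, l - 1]\<close> and \<open>[k + 1, l]\<close> are
  \<open>[s - l + 1, s - k]\<close> and \<open>[s - l, s - k - 1]\<close>. So the two predecessors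
  of \<open>(k, l)\<close> correspond to those of \<open>(s - l, s - k)\<close> with the roles of
  \<open>p\<close> and \<open>q\<close> exchanged.\<close>

lemma coef_reflect_step:
  assumes "k < l"
    and P: "\<And>i. i \<in> {k..l - 1} \<Longrightarrow> p_vec R k (l - 1) $ i = cnj (q_vec R (s - l + 1) (s - k) $ (s - i))"
    and Q: "\<And>i. i \<in> {k + 1..l} \<Longrightarrow> q_vec R (k + 1) l $ i = cnj (p_vec R (s - l) (s - k - 1) $ (s - i))"
  shows "a_coef R k l = cnj (a'_coef R (s - l) (s - k))"
    and "a'_coef R k l = cnj (a_coef R (s - l) (s - k))"
    and "i \<in> {k..l} \<Longrightarrow> p_vec R k l $ i = cnj (q_vec R (s - l) (s - k) $ (s - i))"
    and "i \<in> {k..l} \<Longrightarrow> q_vec R k l $ i = cnj (p_vec R (s - l) (s - k) $ (s - i))"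
proof -
  have dim: "dim_row R = n" using carrier by auto
  have lt: "s - l < s - k" using assms bounds by auto
  \<comment> \<open>At the added endpoint \<open>i = l\<close> both sides vanish: \<open>l\<close>
    and \<open>s - l\<close> lie just outside the respective supports. The relation thus holds on
    all of \<open>[k, l]\<close>.\<close>
  have P': "p_vec R k (l - 1) $ i = cnj (q_vec R (s - l + 1) (s - k) $ (s - i))" if "i \<in> {k..l}" for i
  proof (cases "i = l")
    case True
    then show ?thesis
      using p_q_vec_support[of k "l - 1" l R] p_q_vec_support[of "s - l + 1" "s - k" "s - l" R]
        \<open>k < l\<close> lt bounds dim by auto
  qed (use P that in auto)
  have Q': "q_vec R (k + 1) l $ i = cnj (p_vec R (s - l) (s - k - 1) $ (s - i))" if "i \<in> {k..l}" for i
  proof (cases "i = k")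
    case True
    then show ?thesis
      using p_q_vec_support[of "k + 1" l k R] p_q_vec_support[of "s - l" "s - k - 1" "s - k" R]
        \<open>k < l\<close> lt bounds dim by auto
  qed (use Q that in auto)
  have prod_P: "p_vec R k (l - 1) \<bullet> (R *\<^sub>v unit_vec n j)
      = cnj (q_vec R (s - l + 1) (s - k) \<bullet> (R *\<^sub>v unit_vec n (s - j)))" if "j \<in> {k..l}" for j
    using that P' p_q_vec_support[of k "l - 1" _ R] p_q_vec_support[of "s - l + 1" "s - k" _ R] lt \<open>k < l\<close> dim
    by (intro scalar_prod_reflect) (auto intro!: carrier_vecI)
  have prod_Q: "q_vec R (k + 1) l \<bullet> (R *\<^sub>v unit_vec n j)
      = cnj (p_vec R (s - l) (s - k - 1) \<bullet> (R *\<^sub>v unit_vec n (s - j)))" if "j \<in> {k..l}" for j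
    using that Q' p_q_vec_support[of "k + 1" l _ R] p_q_vec_support[of "s - l" "s - k - 1" _ R] lt \<open>k < l\<close> dim
    by (intro scalar_prod_reflect) (auto intro!: carrier_vecI)
  \<comment> \<open>Column \<open>l\<close> reflects to column \<open>s - l\<close>, the lower end
    of the image interval, which is the column used by \<open>a'_coef\<close>. Numerator and
    denominator therefore correspond separately.\<close>
  show a: "a_coef R k l = cnj (a'_coef R (s - l) (s - k))"
    unfolding a_coef.simps[of R k l] a'_coef.simps[of R "s - l" "s - k"]
    using \<open>k < l\<close> lt dim prod_P[of l] prod_Q[of l] by simp
  show a': "a'_coef R k l = cnj (a_coef R (s - l) (s - k))"
    unfolding a'_coef.simps[of R k l] a_coef.simps[of R "s - l" "s - k"]
    using \<open>k < l\<close> lt dim prod_P[of k] prod_Q[of k] by simp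
  assume i: "i \<in> {k..l}"
  then have "i < n" "s - i < n" using bounds by auto
  with i show "p_vec R k l $ i = cnj (q_vec R (s - l) (s - k) $ (s - i))"
    and "q_vec R k l $ i = cnj (p_vec R (s - l) (s - k) $ (s - i))"
    using \<open>k < l\<close> lt dim a a' P' Q' by (simp_all add: index_p_vec index_q_vec)
qed

end

text \<open>Stated outside the locale because the induction varies \<open>k\<close> and
  \<open>l\<close>, while \<open>s\<close> stays fixed.\<close>

lemma p_q_vec_reflect:
  assumes "reflection_symmetric R n s k l" "i \<in> {k..l}"
  shows "p_vec R k l $ i = cnj (q_vec R (s - l) (s - k) $ (s - i)) \<and>
    q_vec R k l $ i = cnj (p_vec R (s - l) (s - k) $ (s - i))"
  using assms
proof (induction "l - k" arbitrary: k l i rule: less_induct)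
  case less
  interpret reflection_symmetric R n s k l by (rule less.prems)
  show ?case
  proof (cases "k < l")
    case True
    have "p_vec R k (l - 1) $ i = cnj (q_vec R (s - l + 1) (s - k) $ (s - i))" if "i \<in> {k..l - 1}" for i
      using less.hyps[of "l - 1" k i] that True bounds
        reflection_symmetric_subinterval[OF less.prems(1), of k "l - 1"] by (auto simp: Suc_diff_le)
    moreover have "q_vec R (k + 1) l $ i = cnj (p_vec R (s - l) (s - k - 1) $ (s - i))"
      if "i \<in> {k + 1..l}" for i
      using less.hyps[of l "k + 1" i] that True
        reflection_symmetric_subinterval[OF less.prems(1), of "k + 1" l] by auto
    ultimately show ?thesis
      using coef_reflect_step(3,4)[OF True] less.prems(2) by blast
  next
    case False
    \<comment> \<open>Here \<open>k = l\<close>: both vectors are unit vectors, with entry 1 at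
      \<open>k\<close> and at \<open>s - k\<close>.\<close>
    then show ?thesis
      using less.prems(2) bounds carrier by (auto simp: p_vec.simps q_vec.simps)
  qed
qed

context reflection_symmetric
begin

lemma coef_reflect:
  assumes "k < l"
  shows "a_coef R k l = cnj (a'_coef R (s - l) (s - k))"
    and "a'_coef R k l = cnj (a_coef R (s - l) (s - k))"
proof -
  have P: "p_vec R k (l - 1) $ i = cnj (q_vec R (s - l + 1) (s - k) $ (s - i))" if "i \<in> {k..l - 1}" for i
    using p_q_vec_reflect[OF reflection_symmetric_subinterval[OF reflection_symmetric_axioms, of k "l - 1"]]
      that assms bounds by (auto simp: Suc_diff_le)
  have Q: "q_vec R (k + 1) l $ i = cnj (p_vec R (s - l) (s - k - 1) $ (s - i))" if "i \<in> {k + 1..l}" for i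
    using p_q_vec_reflect[OF reflection_symmetric_subinterval[OF reflection_symmetric_axioms, of "k + 1" l]]
      that assms by auto
  show "a_coef R k l = cnj (a'_coef R (s - l) (s - k))"
    and "a'_coef R k l = cnj (a_coef R (s - l) (s - k))"
    using coef_reflect_step(1,2)[OF assms P Q] by auto
qed

lemma v_reflect:
  shows "v_coef R k l = cnj (v'_coef R (s - l) (s - k))"
    and "v'_coef R k l = cnj (v_coef R (s - l) (s - k))"
  unfolding v_coef_def v'_coef_def
  using carrier bounds p_q_vec_reflect[OF reflection_symmetric_axioms]
    p_q_vec_support[of k l _ R] p_q_vec_support[of "s - l" "s - k" _ R]
  by (auto intro!: scalar_prod_reflect carrier_vecI)

end

section \<open>Shift powers, and the reflection as a reversal followed by a shift\<close>

lemma shift_mat_pow_mult_vec: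
  assumes "x \<in> carrier_vec n"
  shows "shift_mat n ^\<^sub>m t *\<^sub>v x = vec n (\<lambda>i. if t \<le> i then x $ (i - t) else 0)"
  using assms
proof (induction t arbitrary: x)
  case 0
  then show ?case by (intro eq_vecI) (auto simp: shift_mat_def)
next
  case (Suc t)
  have S: "shift_mat n \<in> carrier_mat n n" by (simp add: shift_mat_def)
  have step: "shift_mat n *\<^sub>v x = vec n (\<lambda>i. if 1 \<le> i then x $ (i - 1) else 0)"
  proof (intro eq_vecI)
    fix i assume "i < dim_vec (vec n (\<lambda>i. if 1 \<le> i then x $ (i - 1) else 0))"
    then have i: "i < n" by simp
    \<comment> \<open>The guard \<open>1 \<le> i\<close> excludes row 0, where \<open>i - 1\<close>
      truncates to 0.\<close>
    have "(shift_mat n *\<^sub>v x) $ i = (\<Sum>j = 0..<n. if j = i - 1 \<and> 1 \<le> i then x $ j else 0)"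
      using i Suc.prems by (auto simp: shift_mat_def scalar_prod_def intro!: sum.cong)
    also have "\<dots> = (if 1 \<le> i then x $ (i - 1) else 0)"
      using i by (cases "1 \<le> i") auto
    finally show "(shift_mat n *\<^sub>v x) $ i = vec n (\<lambda>i. if 1 \<le> i then x $ (i - 1) else 0) $ i"
      using i by simp
  qed (simp add: shift_mat_def)
  \<comment> \<open>Powers grow on the right, so the induction hypothesis is applied to the
    once-shifted vector; hence \<open>x\<close> is arbitrary in the induction.\<close>
  have "shift_mat n ^\<^sub>m Suc t *\<^sub>v x = shift_mat n ^\<^sub>m t *\<^sub>v (shift_mat n *\<^sub>v x)"
    using assoc_mult_mat_vec[OF pow_carrier_mat[OF S] S Suc.prems] by simp
  also have "\<dots> = vec n (\<lambda>i. if Suc t \<le> i then x $ (i - Suc t) else 0)"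
    unfolding step by (subst Suc.IH) (auto intro!: eq_vecI)
  finally show ?case .
qed

lemma transpose_shift_mat_pow_mult_vec:
  assumes "x \<in> carrier_vec n"
  shows "(shift_mat n)\<^sup>T ^\<^sub>m t *\<^sub>v x = vec n (\<lambda>i. if i + t < n then x $ (i + t) else 0)"
  using assms
proof (induction t arbitrary: x)
  case 0
  then show ?case by (intro eq_vecI) (auto simp: shift_mat_def)
next
  case (Suc t)
  have S: "(shift_mat n)\<^sup>T \<in> carrier_mat n n" by (simp add: shift_mat_def)
  have step: "(shift_mat n)\<^sup>T *\<^sub>v x = vec n (\<lambda>i. if i + 1 < n then x $ (i + 1) else 0)"
  proof (intro eq_vecI)
    fix i assume "i < dim_vec (vec n (\<lambda>i. if i + 1 < n then x $ (i + 1) else 0))"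
    then have i: "i < n" by simp
    have "((shift_mat n)\<^sup>T *\<^sub>v x) $ i = (if i + 1 < n then x $ (i + 1) else 0)"
      using i Suc.prems
      by (auto simp: shift_mat_def scalar_prod_def if_distrib[of "\<lambda>c. c * _"] cong: if_cong)
    then show "((shift_mat n)\<^sup>T *\<^sub>v x) $ i = vec n (\<lambda>i. if i + 1 < n then x $ (i + 1) else 0) $ i"
      using i by simp
  qed (simp add: shift_mat_def)
  have "(shift_mat n)\<^sup>T ^\<^sub>m Suc t *\<^sub>v x = (shift_mat n)\<^sup>T ^\<^sub>m t *\<^sub>v ((shift_mat n)\<^sup>T *\<^sub>v x)"
    using assoc_mult_mat_vec[OF pow_carrier_mat[OF S] S Suc.prems] by simp
  also have "\<dots> = vec n (\<lambda>i. if i + Suc t < n then x $ (i + Suc t) else 0)"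
    unfolding step by (subst Suc.IH) (auto intro!: eq_vecI)
  finally show ?case .
qed

text \<open>One formula for both signs. For \<open>k' \<le> k\<close> the upper bound is automatic,
  for \<open>k \<le> k'\<close> the lower one; each remaining test marks where the shift fills in
  zeros.\<close>

lemma shift_power_mult_vec:
  assumes "x \<in> carrier_vec n"
  shows "shift_power n (int k - int k') *\<^sub>v x =
    vec n (\<lambda>i. if k \<le> i + k' \<and> i + k' < n + k then x $ (i + k' - k) else 0)"
proof (cases "k' \<le> k")
  case True
  then have "nat (int k - int k') = k - k'" by auto
  then show ?thesis
    using True assms by (auto simp: shift_power_def shift_mat_pow_mult_vec intro!: eq_vecI)
next
  case False
  then have "nat (- (int k - int k')) = k' - k" by auto
  then show ?thesis
    using False assms by (auto simp: shift_power_def transpose_shift_mat_pow_mult_vec intro!: eq_vecI)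
qed

text \<open>The tilde reverses \<open>[s - l, s - k]\<close> and the shift moves this interval onto
  \<open>[k, l]\<close>; the composite reads \<open>y\<close> at \<open>s - i\<close>. Outside
  \<open>[k, l]\<close> both sides vanish.\<close>

lemma eq_shift_conjugate_tilde:
  assumes "x \<in> carrier_vec n" "y \<in> carrier_vec n" "k \<le> l" "l \<le> s" "s - k < n"
    and x0: "\<And>i. i < n \<Longrightarrow> i \<notin> {k..l} \<Longrightarrow> x $ i = 0"
    and y0: "\<And>i. i < n \<Longrightarrow> i \<notin> {s - l..s - k} \<Longrightarrow> y $ i = (0::complex)"
    and xy: "\<And>i. i \<in> {k..l} \<Longrightarrow> x $ i = cnj (y $ (s - i))"
  shows "x = shift_power n (int k - int (s - l)) *\<^sub>v conjugate (tilde (s - l) (s - k) y)"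
proof -
  have y: "conjugate (tilde (s - l) (s - k) y) \<in> carrier_vec n"
    using assms(2) by (auto simp: tilde_def intro!: carrier_vecI)
  show ?thesis unfolding shift_power_mult_vec[OF y]
  proof (intro eq_vecI)
    fix i assume "i < dim_vec (vec n (\<lambda>i. if k \<le> i + (s - l) \<and> i + (s - l) < n + k
        then conjugate (tilde (s - l) (s - k) y) $ (i + (s - l) - k) else 0))"
    then have i: "i < n" by simp
    \<comment> \<open>\<open>j\<close> is the position before the shift of the entry that lands at
      \<open>i\<close>; for \<open>i\<close> in \<open>[k, l]\<close> the tilde takes
      \<open>j\<close> to \<open>s - i\<close>.\<close>
    define j where "j = i + (s - l) - k"
    have "x $ i = (if k \<le> i + (s - l) \<and> i + (s - l) < n + k
        then conjugate (tilde (s - l) (s - k) y) $ j else 0)"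
    proof (cases "i \<in> {k..l}")
      case True
      then have j: "s - l \<le> j" "j \<le> s - k" "s - k - j + (s - l) = s - i" "j < n"
        using assms(3-5) by (auto simp: j_def)
      then show ?thesis using xy[OF True] True assms(2-5) by (auto simp: tilde_def)
    next
      case False
      show ?thesis
      proof (cases "k \<le> i + (s - l) \<and> i + (s - l) < n + k")
        case True
        then have "j < n" "j \<notin> {s - l..s - k}" using False assms(3-5) by (auto simp: j_def)
        then have "conjugate (tilde (s - l) (s - k) y) $ j = 0"
          using y0[of j] assms(2) by (auto simp: tilde_def)
        then show ?thesis using x0[OF i False] by simp
      qed (use x0[OF i False] in auto)
    qed
    with i show "x $ i = vec n (\<lambda>i. if k \<le> i + (s - l) \<and> i + (s - l) < n + k
        then conjugate (tilde (s - l) (s - k) y) $ (i + (s - l) - k) else 0) $ i"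
      by (simp add: j_def)
  qed (use assms in simp)
qed

section \<open>The reflection in block coordinates\<close>

lemma div_mod_reflect:
  fixes m i b :: nat
  assumes "0 < m" "i div m \<le> b"
  shows "(m * b + (m - 1) - i) div m = b - i div m"
    and "(m * b + (m - 1) - i) mod m = m - 1 - i mod m"
proof -
  have lt: "i mod m < m" using assms by simp
  \<comment> \<open>Subtracting from a number with the largest remainder \<open>m - 1\<close> causes
    no borrow, so this is already the division with remainder by \<open>m\<close>.\<close>
  have eq: "m * b + (m - 1) - i = m * (b - i div m) + (m - 1 - i mod m)"
  proof -
    have "m * b = m * (b - i div m) + m * (i div m)"
      using assms by (simp flip: distrib_left)
    moreover have "i = m * (i div m) + i mod m" by simp
    ultimately show ?thesis using lt by linarith
  qed
  have small: "m - 1 - i mod m < m" using assms by simp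
  show "(m * b + (m - 1) - i) div m = b - i div m"
    and "(m * b + (m - 1) - i) mod m = m - 1 - i mod m"
    unfolding eq using small by (simp_all add: div_mult_self3)
qed

lemma hermitian_entry:
  fixes R :: "complex mat"
  assumes "mat_adjoint R = R" "R \<in> carrier_mat n n" "i < n" "j < n"
  shows "R $$ (j, i) = cnj (R $$ (i, j))"
proof -
  have "R $$ (j, i) = mat_adjoint R $$ (j, i)" using assms(1) by simp
  also have "\<dots> = cnj (R $$ (i, j))"
    using assms(2-4) by (auto simp: mat_adjoint_def mat_of_rows_def)
  finally show ?thesis .
qed

text \<open>The reflection negates both the block difference and the difference inside the blocks,
  as does swapping \<open>i\<close> and \<open>j\<close>. The Toeplitz structure thus gives
  \<open>R $$ (j, i)\<close>, and hermiticity turns it into a conjugate.\<close>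

lemma toeplitz_block_toeplitz_reflect:
  fixes R :: "complex mat"
  assumes "toeplitz_block_toeplitz n1 n2 R" "mat_adjoint R = R" "0 < n1"
    and ij: "i < n1 * n2" "j < n1 * n2"
    and b: "i div n1 \<le> b" "j div n1 \<le> b" "n1 * b + (n1 - 1) - i < n1 * n2"
      "n1 * b + (n1 - 1) - j < n1 * n2"
  shows "R $$ (n1 * b + (n1 - 1) - i, n1 * b + (n1 - 1) - j) = cnj (R $$ (i, j))"
proof -
  have R: "R \<in> carrier_mat (n1 * n2) (n1 * n2)"
    using assms(1) by (simp add: toeplitz_block_toeplitz_def)
  let ?\<rho> = "\<lambda>i. n1 * b + (n1 - 1) - i"
  note reflect = div_mod_reflect[OF \<open>0 < n1\<close> b(1)] div_mod_reflect[OF \<open>0 < n1\<close> b(2)]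
  have "i mod n1 < n1" "j mod n1 < n1" using \<open>0 < n1\<close> by auto
  then have "int (?\<rho> j div n1) - int (?\<rho> i div n1) = int (i div n1) - int (j div n1)"
    "int (?\<rho> j mod n1) - int (?\<rho> i mod n1) = int (i mod n1) - int (j mod n1)"
    unfolding reflect using b(1,2) by linarith+
  then have "R $$ (?\<rho> i, ?\<rho> j) = R $$ (j, i)"
    using assms(1) b(3,4) ij unfolding toeplitz_block_toeplitz_def by blast
  also have "\<dots> = cnj (R $$ (i, j))"
    using assms(2) R ij by (rule hermitian_entry)
  finally show ?thesis .
qed

theorem theorem1:
  fixes n1 n2 n k l k' l' :: nat and R :: "complex mat"
  assumes "n1 \<ge> 1" and "n2 \<ge> 1" and "n = n1 * n2"
    and "R \<in> carrier_mat n n"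
    and "hermitian_positive_definite R"
    and "toeplitz_block_toeplitz n1 n2 R"
    and "k < l" and "l < n"
    and "k' = k sec n1 + n1 - 1 - l mod n1"
    and "l' = l sec n1 + n1 - 1 - k mod n1"
  shows "a_coef R k l = cnj (a'_coef R k' l') \<and>
      a'_coef R k l = cnj (a_coef R k' l') \<and>
      p_vec R k l = shift_power n (int k - int k') *\<^sub>v conjugate (tilde k' l' (q_vec R k' l')) \<and>
      q_vec R k l = shift_power n (int k - int k') *\<^sub>v conjugate (tilde k' l' (p_vec R k' l')) \<and>
      v_coef R k l = cnj (v'_coef R k' l') \<and>
      v'_coef R k l = cnj (v_coef R k' l')"
proof -
  \<comment> \<open>The shape \<open>n1 * b + (n1 - 1)\<close> with
    \<open>b = k div n1 + l div n1\<close>, as needed for the reflection in block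
    coordinates.\<close>
  define s where "s = n1 * (k div n1 + l div n1) + (n1 - 1)"
  have "0 < n1" using assms(1) by simp
  have decomp: "k = n1 * (k div n1) + k mod n1" "l = n1 * (l div n1) + l mod n1"
    "k mod n1 < n1" "l mod n1 < n1"
    using \<open>0 < n1\<close> by simp_all
  have k': "k' = s - l" and l': "l' = s - k" and "l \<le> s"
    using decomp assms(9,10) unfolding s_def sec_def distrib_left by linarith+
  \<comment> \<open>The index \<open>s - k\<close> lies in the same block as \<open>l\<close>, and
    that whole block lies below \<open>n\<close>.\<close>
  have "l div n1 < n2"
    using \<open>l < n\<close> \<open>0 < n1\<close> assms(3) by (simp add: less_mult_imp_div_less mult.commute)
  then have "n1 * (l div n1) + n1 \<le> n"
    using assms(3) by (metis Suc_leI mult_le_mono2 mult_Suc_right add.commute)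
  then have "s - k < n"
    using decomp unfolding s_def distrib_left by linarith
  interpret reflection_symmetric R n s k l
  proof
    fix i j assume i: "i \<in> {k..l}" and j: "j \<in> {k..l}"
    \<comment> \<open>This bounds the block indices by \<open>b\<close>, so that their reflection
      \<open>b - i div n1\<close> is not truncated.\<close>
    have "i div n1 \<le> l div n1" "j div n1 \<le> l div n1" using i j by (auto intro: div_le_mono)
    then show "R $$ (s - i, s - j) = cnj (R $$ (i, j))"
      using i j assms \<open>s - k < n\<close> unfolding s_def hermitian_positive_definite_def
      by (intro toeplitz_block_toeplitz_reflect[of n1 n2]) auto
  qed (use assms \<open>l \<le> s\<close> \<open>s - k < n\<close> in auto)
  have p: "p_vec R k l = shift_power n (int k - int k') *\<^sub>v conjugate (tilde k' l' (q_vec R k' l'))"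
    and q: "q_vec R k l = shift_power n (int k - int k') *\<^sub>v conjugate (tilde k' l' (p_vec R k' l'))"
    unfolding k' l'
    by (rule eq_shift_conjugate_tilde;
        use carrier bounds p_q_vec_reflect[OF reflection_symmetric_axioms]
          p_q_vec_support[of k l _ R] p_q_vec_support[of "s - l" "s - k" _ R]
        in \<open>force intro!: carrier_vecI\<close>)+
  show ?thesis
    using p q coef_reflect[OF \<open>k < l\<close>] v_reflect unfolding k' l' by blast
qed

end
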